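(* Consider the system with state $X=(x_1,x_2,x_3,x_4)$ and scalar control input $u$, $$\dot{x}_1 = x_2,\qquad \dot{x}_2 = f_1(X) + b_1(X)u,\qquad \dot{x}_3 = x_4,\qquad \dot{x}_4 = f_2(X) + b_2(X)u,$$ and assume that $f_1 = k f_2$ and $b_1 = k b_2 \neq 0$, where $k$ is a nonzero constant. Then the system satisfies the hypotheses (A1) $0\le |f_i(X)|\le M_i$ for $X\in A_d^c$, and (A2) $0<|b_i(X)|\le B_i$ for $X\in A_d^c$ ($i=1,2$). However, the system cannot be stabilized to the origin by any control input for initial states satisfying $x_1(0)\neq 0$, $x_2(0)=x_3(0)=x_4(0)=0$.
   Context: The functions $f_1,f_2,b_1,b_2$ are real-valued functions of the state $X\in\mathbb{R}^4$. In (A1) and (A2), $M_i$ and $B_i$ are finite constants, and $A_d^c$ denotes a bounded region of the state space, that is, a region on which a weighted sup norm $\|X\|_{\infty,w}$ of the state is bounded. The system is the four-state case of a class of under-actuated mechanical systems, for which (A1) and (A2) are the hypotheses under which two sliding-mode control schemes had been claimed to make the state errors converge to zero. The example is offered as a counterexample to those claims.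
   Formalization: The claim that (A1) and (A2) hold is proved under the added assumption that f_2 and b_2 are continuous on R^4, since it fails for arbitrary real-valued functions (f_2 may be unbounded near a point); the non-stabilizability claim needs no such assumption. *)

theory Defs
  imports "HOL-Analysis.Analysis"
begin

type_synonym state = "real ^ 4"

definition vector_field ::
  "(state \<Rightarrow> real) \<Rightarrow> (state \<Rightarrow> real) \<Rightarrow> (state \<Rightarrow> real) \<Rightarrow> (state \<Rightarrow> real) \<Rightarrow> state \<Rightarrow> real \<Rightarrow> state"
  where
  "vector_field f1 f2 b1 b2 X v =
     vector [X $ 2, f1 X + b1 X * v, X $ 4, f2 X + b2 X * v]"

text \<open>
  Sliding-mode inputs are discontinuous, so solutions are taken in integral form. With the
  Henstock-Kurzweil integral this covers everywhere differentiable solutions as well as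
  Caratheodory solutions (absolutely continuous, equation holding almost everywhere).

  The input may depend on time and state in an arbitrary way. An input that ignores the state is
  an open-loop signal; an input produced by a dynamic controller is covered by the signal that it
  realises along the trajectory.
\<close>

definition trajectory ::
  "(state \<Rightarrow> real) \<Rightarrow> (state \<Rightarrow> real) \<Rightarrow> (state \<Rightarrow> real) \<Rightarrow> (state \<Rightarrow> real)
    \<Rightarrow> (real \<Rightarrow> state \<Rightarrow> real) \<Rightarrow> (real \<Rightarrow> state) \<Rightarrow> bool"
  where
  "trajectory f1 f2 b1 b2 u X \<longleftrightarrow>
     (\<forall>t\<ge>0. ((\<lambda>s. vector_field f1 f2 b1 b2 (X s) (u s (X s))) has_integral (X t - X 0)) {0..t})"

text \<open>
  No uniqueness of solutions is assumed. Only one convergent trajectory is required here, so that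
  the negation says that no trajectory from the given initial state tends to the origin.
\<close>

definition stabilizes_from ::
  "(state \<Rightarrow> real) \<Rightarrow> (state \<Rightarrow> real) \<Rightarrow> (state \<Rightarrow> real) \<Rightarrow> (state \<Rightarrow> real)
    \<Rightarrow> (real \<Rightarrow> state \<Rightarrow> real) \<Rightarrow> state \<Rightarrow> bool"
  where
  "stabilizes_from f1 f2 b1 b2 u X0 \<longleftrightarrow>
     (\<exists>X. trajectory f1 f2 b1 b2 u X \<and> X 0 = X0 \<and> (X \<longlongrightarrow> 0) at_top)"

definition weighted_sup_norm :: "real ^ 4 \<Rightarrow> state \<Rightarrow> real" where
  "weighted_sup_norm w X = (MAX i\<in>UNIV. \<bar>X $ i\<bar> / w $ i)"

definition bounded_region :: "real ^ 4 \<Rightarrow> state set \<Rightarrow> bool" where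
  "bounded_region w A \<longleftrightarrow> (\<forall>i. w $ i > 0) \<and> (\<exists>r. \<forall>X\<in>A. weighted_sup_norm w X \<le> r)"

definition hyp_A1 :: "(state \<Rightarrow> real) \<Rightarrow> (state \<Rightarrow> real) \<Rightarrow> state set \<Rightarrow> bool" where
  "hyp_A1 f1 f2 A \<longleftrightarrow>
     (\<exists>M1 M2. \<forall>X\<in>A. 0 \<le> \<bar>f1 X\<bar> \<and> \<bar>f1 X\<bar> \<le> M1 \<and> 0 \<le> \<bar>f2 X\<bar> \<and> \<bar>f2 X\<bar> \<le> M2)"

definition hyp_A2 :: "(state \<Rightarrow> real) \<Rightarrow> (state \<Rightarrow> real) \<Rightarrow> state set \<Rightarrow> bool" where
  "hyp_A2 b1 b2 A \<longleftrightarrow>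
     (\<exists>B1 B2. \<forall>X\<in>A. 0 < \<bar>b1 X\<bar> \<and> \<bar>b1 X\<bar> \<le> B1 \<and> 0 < \<bar>b2 X\<bar> \<and> \<bar>b2 X\<bar> \<le> B2)"

end

theory Submission
  imports Defs
begin

text \<open>
  Proportionality of \<open>f\<close> and \<open>b\<close> means that the input, whatever its value, pushes the two
  subsystems in the fixed ratio \<open>k\<close>. In the difference coordinates \<open>p = x\<^sub>1 - k x\<^sub>3\<close> and
  \<open>q = x\<^sub>2 - k x\<^sub>4\<close> both the drift and the input cancel, leaving \<open>p' = q\<close>, \<open>q' = 0\<close>: a double
  integrator that no input reaches. If \<open>q\<close> vanishes initially, \<open>p\<close> is conserved
  (\<open>trajectory_conserves_position\<close>), whereas convergence to the origin would force \<open>p\<close> to tend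
  to \<open>0\<close>; hence \<open>p\<close> must be \<open>0\<close> from the start, which the given initial states violate.
  Both conservation laws are read off the integral equation (\<open>trajectory_difference_has_integral\<close>)
  by finding the integrand \<open>0\<close>; nothing is differentiated, so the argument applies to
  discontinuous inputs as they stand.

  The upper bounds in (A1) and (A2) are compactness: a set bounded in the weighted sup norm has
  compact closure, on which continuous functions are bounded. Strict positivity in (A2) is the
  assumption that \<open>b\<^sub>1\<close>, and with it \<open>b\<^sub>2\<close>, has no zero.
\<close>

lemma bounded_region_imp_bounded:
  assumes "bounded_region w A"
  shows "bounded A"
proof -
  from assms obtain r where w: "\<And>i. w $ i > 0"
    and r: "\<And>X. X \<in> A \<Longrightarrow> weighted_sup_norm w X \<le> r"
    unfolding bounded_region_def by blast
  have "norm X \<le> (\<Sum>i\<in>UNIV. r * w $ i)" if "X \<in> A" for X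
  proof -
    have "\<bar>X $ i\<bar> \<le> r * w $ i" for i
    proof -
      have "\<bar>X $ i\<bar> / w $ i \<le> weighted_sup_norm w X"
        unfolding weighted_sup_norm_def by (rule Max_ge) auto
      then have "\<bar>X $ i\<bar> / w $ i \<le> r"
        using r[OF that] by linarith
      then show ?thesis
        using w[of i] by (simp add: pos_divide_le_eq)
    qed
    then show ?thesis
      using norm_le_l1_cart[of X] by (meson order_trans sum_mono)
  qed
  then show ?thesis
    unfolding bounded_iff by blast
qed

lemma continuous_bounded_on_bounded_set:
  fixes f :: "'a::heine_borel \<Rightarrow> real"
  assumes "continuous_on UNIV f" "bounded A"
  obtains M where "\<And>x. x \<in> A \<Longrightarrow> \<bar>f x\<bar> \<le> M"
proof -
  have "compact (f ` closure A)"
    using assms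
    by (intro compact_continuous_image) (auto intro: continuous_on_subset simp: compact_closure)
  then have "bounded (f ` closure A)"
    by (rule compact_imp_bounded)
  then obtain M where "\<And>x. x \<in> closure A \<Longrightarrow> \<bar>f x\<bar> \<le> M"
    unfolding bounded_iff by auto
  then show thesis
    using that closure_subset by blast
qed

lemma vector_field_nth [simp]:
  "vector_field f1 f2 b1 b2 X v $ 1 = X $ 2"
  "vector_field f1 f2 b1 b2 X v $ 2 = f1 X + b1 X * v"
  "vector_field f1 f2 b1 b2 X v $ 3 = X $ 4"
  "vector_field f1 f2 b1 b2 X v $ 4 = f2 X + b2 X * v"
  by (simp_all add: vector_field_def vector_def)

text \<open>
  The difference coordinates are bounded linear functionals of the state, and these commute with
  the integral. The cases \<open>(i, j) = (2, 4)\<close> and \<open>(1, 3)\<close> give \<open>q\<close> and \<open>p\<close>.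
\<close>

lemma trajectory_difference_has_integral:
  fixes k :: real
  assumes "trajectory f1 f2 b1 b2 u X" "t \<ge> 0"
  shows "((\<lambda>s. vector_field f1 f2 b1 b2 (X s) (u s (X s)) $ i
             - k * vector_field f1 f2 b1 b2 (X s) (u s (X s)) $ j)
          has_integral (X t $ i - k * X t $ j) - (X 0 $ i - k * X 0 $ j)) {0..t}"
proof -
  have "bounded_linear (\<lambda>Y :: state. Y $ i - k * Y $ j)"
    by (intro bounded_linear_sub bounded_linear_const_mult bounded_linear_vec_nth)
  from has_integral_linear[OF assms(1)[unfolded trajectory_def, rule_format, OF assms(2)] this]
  show ?thesis
    by (simp add: o_def algebra_simps)
qed

lemma trajectory_conserves_velocity:
  assumes "trajectory f1 f2 b1 b2 u X" "t \<ge> 0"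
    and "\<And>Y. f1 Y = k * f2 Y" "\<And>Y. b1 Y = k * b2 Y"
  shows "X t $ 2 - k * X t $ 4 = X 0 $ 2 - k * X 0 $ 4"
proof -
  \<comment> \<open>The integrand is \<open>(f1 + b1 v) - k (f2 + b2 v)\<close>, which vanishes at every state for every
    input value \<open>v\<close>.\<close>
  have "((\<lambda>s. 0) has_integral (X t $ 2 - k * X t $ 4) - (X 0 $ 2 - k * X 0 $ 4)) {0..t}"
    using trajectory_difference_has_integral[OF assms(1,2), of 2 k 4]
    by (simp add: assms(3,4) algebra_simps)
  then show ?thesis
    using has_integral_0_eq by fastforce
qed

lemma trajectory_conserves_position:
  assumes "trajectory f1 f2 b1 b2 u X" "t \<ge> 0"
    and "\<And>Y. f1 Y = k * f2 Y" "\<And>Y. b1 Y = k * b2 Y"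
    and "X 0 $ 2 = k * X 0 $ 4"
  shows "X t $ 1 - k * X t $ 3 = X 0 $ 1 - k * X 0 $ 3"
proof -
  have "X s $ 2 - k * X s $ 4 = 0" if "s \<in> {0..t}" for s
    using trajectory_conserves_velocity[OF assms(1) _ assms(3,4), of s] that assms(5) by simp
  then have "((\<lambda>s. 0) has_integral (X t $ 1 - k * X t $ 3) - (X 0 $ 1 - k * X 0 $ 3)) {0..t}"
    using trajectory_difference_has_integral[OF assms(1,2), of 1 k 3]
    by (intro has_integral_eq[where g = "\<lambda>s. 0"]) auto
  then show ?thesis
    using has_integral_0_eq by fastforce
qed

text \<open>
  A necessary condition on the initial state, common to all inputs: among states with \<open>q = 0\<close>, only
  those on the hyperplane \<open>p = 0\<close> can be steered to the origin, since \<open>p\<close> is constant along the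
  trajectory and continuous at its limit.
\<close>

lemma stabilizes_from_imp_position_zero:
  assumes "stabilizes_from f1 f2 b1 b2 u X0"
    and "\<And>Y. f1 Y = k * f2 Y" "\<And>Y. b1 Y = k * b2 Y"
    and "X0 $ 2 = k * X0 $ 4"
  shows "X0 $ 1 = k * X0 $ 3"
proof -
  from assms(1) obtain X where tr: "trajectory f1 f2 b1 b2 u X"
    and X0: "X 0 = X0" and lim: "(X \<longlongrightarrow> 0) at_top"
    unfolding stabilizes_from_def by blast
  have "((\<lambda>t. X t $ 1 - k * X t $ 3) \<longlongrightarrow> (0 :: state) $ 1 - k * (0 :: state) $ 3) at_top"
    by (intro tendsto_diff tendsto_mult_left tendsto_vec_nth lim)
  moreover have "\<forall>\<^sub>F t in at_top. X t $ 1 - k * X t $ 3 = X0 $ 1 - k * X0 $ 3"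
    using eventually_ge_at_top[of 0]
  proof eventually_elim
    case (elim t)
    with trajectory_conserves_position[OF tr _ assms(2,3)] show ?case
      using X0 assms(4) by simp
  qed
  ultimately have "((\<lambda>t::real. X0 $ 1 - k * X0 $ 3) \<longlongrightarrow> 0) at_top"
    by (simp add: tendsto_cong)
  then show ?thesis
    by (simp add: tendsto_const_iff)
qed

theorem mainTheorem1:
  fixes f1 f2 b1 b2 :: "state \<Rightarrow> real" and k :: real
  assumes "k \<noteq> 0"
    and "\<And>X. f1 X = k * f2 X"
    and "\<And>X. b1 X = k * b2 X"
    and "\<And>X. b1 X \<noteq> 0"
  shows "(continuous_on UNIV f2 \<and> continuous_on UNIV b2 \<longrightarrow>
            (\<forall>w A. bounded_region w A \<longrightarrow> hyp_A1 f1 f2 A \<and> hyp_A2 b1 b2 A))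
       \<and> (\<forall>u X0. X0 $ 1 \<noteq> 0 \<and> X0 $ 2 = 0 \<and> X0 $ 3 = 0 \<and> X0 $ 4 = 0 \<longrightarrow>
            \<not> stabilizes_from f1 f2 b1 b2 u X0)"
proof (intro conjI impI allI)
  fix w A
  assume "continuous_on UNIV f2 \<and> continuous_on UNIV b2" and "bounded_region w A"
  then have cont: "continuous_on UNIV f2" "continuous_on UNIV b2" and A: "bounded A"
    by (auto intro: bounded_region_imp_bounded)
  obtain M where M: "\<And>X. X \<in> A \<Longrightarrow> \<bar>f2 X\<bar> \<le> M"
    using continuous_bounded_on_bounded_set[OF cont(1) A] by blast
  obtain B where B: "\<And>X. X \<in> A \<Longrightarrow> \<bar>b2 X\<bar> \<le> B"
    using continuous_bounded_on_bounded_set[OF cont(2) A] by blast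
  have "\<bar>f1 X\<bar> \<le> \<bar>k\<bar> * M" if "X \<in> A" for X
    using M[OF that] by (simp add: assms(2) abs_mult mult_left_mono)
  with M show "hyp_A1 f1 f2 A"
    unfolding hyp_A1_def by (meson abs_ge_zero)
  have "\<bar>b1 X\<bar> \<le> \<bar>k\<bar> * B" if "X \<in> A" for X
    using B[OF that] by (simp add: assms(3) abs_mult mult_left_mono)
  moreover have "b2 X \<noteq> 0" for X
    using assms(3,4)[of X] by auto
  ultimately show "hyp_A2 b1 b2 A"
    unfolding hyp_A2_def using B assms(4) by (meson zero_less_abs_iff)
next
  fix u and X0 :: state
  assume "X0 $ 1 \<noteq> 0 \<and> X0 $ 2 = 0 \<and> X0 $ 3 = 0 \<and> X0 $ 4 = 0"
  then show "\<not> stabilizes_from f1 f2 b1 b2 u X0"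
    using stabilizes_from_imp_position_zero[OF _ assms(2,3)] by fastforce
qed

end
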